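(* Let $c\ge 1$ be a real number, let $n\ge 2$ and $d\geq 1$ be integers, and let $P=(p_1,\dots,p_n)$ be a $c$-chain with $n$ vertices in $\mathbb{R}^d$, with $p_1\neq p_n$. Then its stretch factor satisfies $$\delta_P\le c\,(n-1)^{\log c},$$ where $\log$ denotes the logarithm in base $2$.
   Context: A polygonal chain $P=(p_1,\dots,p_n)$ in $\mathbb{R}^d$ is specified by a sequence of $n$ points $p_1,\dots,p_n$, called its vertices; it consists of the $n-1$ line segments between consecutive vertices. $|pq|$ denotes the Euclidean distance between $p$ and $q$. For a real number $c\ge 1$, $P$ is called a $c$-chain if $|p_ip_j|+|p_jp_k|\le c\,|p_ip_k|$ for all $1\le i<j<k\le n$. The stretch factor of $P$ is $$\delta_P=\frac{\sum_{i=1}^{n-1}|p_ip_{i+1}|}{|p_1p_n|}.$$ *)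

theory Defs
  imports "HOL-Analysis.Analysis"
begin

text \<open>
  A polygonal chain with \<open>n\<close> vertices is a function \<open>p\<close> on the indices \<open>1, \<dots>, n\<close>;
  the values of \<open>p\<close> at other indices play no role. Vertices may coincide.
\<close>

definition c_chain :: "real \<Rightarrow> nat \<Rightarrow> (nat \<Rightarrow> real ^ 'd) \<Rightarrow> bool" where
  "c_chain c n p \<longleftrightarrow>
     (\<forall>i j k. 1 \<le> i \<and> i < j \<and> j < k \<and> k \<le> n \<longrightarrow>
        dist (p i) (p j) + dist (p j) (p k) \<le> c * dist (p i) (p k))"

text \<open>Only meaningful for \<open>p 1 \<noteq> p n\<close>; otherwise division by zero yields 0.\<close>

definition stretch_factor :: "nat \<Rightarrow> (nat \<Rightarrow> real ^ 'd) \<Rightarrow> real" where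
  "stretch_factor n p = (\<Sum>i = 1..n - 1. dist (p i) (p (i + 1))) / dist (p 1) (p n)"

end

theory Submission
  imports Defs
begin

text \<open>
  Splitting a subchain at its middle vertex costs a factor \<open>c\<close>, by the \<open>c\<close>-chain condition.
  After \<open>k\<close> rounds of halving, any subchain of at most \<open>2 ^ k\<close> edges has length at most
  \<open>c ^ k\<close> times the distance of its endpoints. With \<open>2 ^ k \<le> n - 1 < 2 ^ (k + 1)\<close>, the whole
  chain needs \<open>k + 1\<close> rounds, and \<open>c ^ k = (2 ^ k) powr log 2 c \<le> (n - 1) powr log 2 c\<close>.
\<close>

lemma c_chain_triangle:
  assumes "c_chain c n p" "c \<ge> 1" "1 \<le> i" "i \<le> j" "j \<le> k" "k \<le> n"
  shows "dist (p i) (p j) + dist (p j) (p k) \<le> c * dist (p i) (p k)"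
proof (cases "i < j \<and> j < k")
  case True
  then show ?thesis using assms unfolding c_chain_def by blast
next
  case False
  then have "dist (p i) (p j) + dist (p j) (p k) = dist (p i) (p k)"
    using assms by (auto simp: not_less)
  also have "\<dots> \<le> c * dist (p i) (p k)"
    using assms(2) by (simp add: mult_le_cancel_right1)
  finally show ?thesis .
qed

lemma c_chain_length_le:
  assumes "c_chain c n p" "c \<ge> 1"
  shows "1 \<le> i \<Longrightarrow> i \<le> j \<Longrightarrow> j \<le> n \<Longrightarrow> j - i \<le> 2 ^ k \<Longrightarrow>
    (\<Sum>l = i..<j. dist (p l) (p (l + 1))) \<le> c ^ k * dist (p i) (p j)"
proof (induction k arbitrary: i j)
  case 0
  then have "j = i \<or> j = i + 1" by auto
  then show ?case by auto
next
  case (Suc k)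
  \<comment> \<open>The longer half has \<open>j - m\<close> edges, half of \<open>j - i\<close>
    rounded up; this is still at most \<open>2 ^ k\<close> because \<open>2 ^ Suc k\<close> is
    even.\<close>
  define m where "m = (i + j) div 2"
  have m: "i \<le> m" "m \<le> j" "m - i \<le> 2 ^ k" "j - m \<le> 2 ^ k"
    using Suc.prems by (auto simp: m_def)
  have "(\<Sum>l = i..<j. dist (p l) (p (l + 1)))
      = (\<Sum>l = i..<m. dist (p l) (p (l + 1))) + (\<Sum>l = m..<j. dist (p l) (p (l + 1)))"
    using m by (simp add: sum.atLeastLessThan_concat)
  also have "\<dots> \<le> c ^ k * dist (p i) (p m) + c ^ k * dist (p m) (p j)"
    using Suc.prems m by (intro add_mono Suc.IH) auto
  also have "\<dots> = c ^ k * (dist (p i) (p m) + dist (p m) (p j))"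
    by (simp add: distrib_left)
  also have "\<dots> \<le> c ^ k * (c * dist (p i) (p j))"
    using Suc.prems m assms by (intro mult_left_mono c_chain_triangle) auto
  finally show ?case by (simp add: mult_ac)
qed

theorem theorem1:
  fixes c :: real and n :: nat and p :: "nat \<Rightarrow> real ^ 'd"
  assumes "c \<ge> 1"
    and "n \<ge> 2"
    and "c_chain c n p"
    and "p 1 \<noteq> p n"
  shows "stretch_factor n p \<le> c * (real n - 1) powr (log 2 c)"
proof -
  obtain k where k: "2 ^ k \<le> n - 1" "n - 1 < 2 ^ (k + 1)"
    using ex_power_ivl1[of 2 "n - 1"] assms(2) by fastforce
  have "{1..n - 1} = {1..<n}" using assms(2) by auto
  then have "(\<Sum>i = 1..n - 1. dist (p i) (p (i + 1))) \<le> c ^ (k + 1) * dist (p 1) (p n)"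
    using c_chain_length_le[OF assms(3,1), of 1 n "k + 1"] k assms(2) by simp
  then have "stretch_factor n p \<le> c * c ^ k"
    using assms(4) by (simp add: stretch_factor_def divide_le_eq)
  also have "c ^ k = (2 powr log 2 c) powr real k"
    using assms(1) by (simp add: powr_realpow)
  also have "\<dots> = (2 ^ k) powr log 2 c"
    by (simp add: powr_powr mult.commute flip: powr_realpow)
  \<comment> \<open>Monotonicity in the base needs a nonnegative exponent:
    \<open>log 2 c \<ge> 0\<close> as \<open>c \<ge> 1\<close>.\<close>
  also have "c * \<dots> \<le> c * (real n - 1) powr log 2 c"
  proof (intro mult_left_mono powr_mono2)
    have "real (2 ^ k) \<le> real (n - 1)" using k(1) by (simp only: of_nat_le_iff)
    then show "2 ^ k \<le> real n - 1" using assms(2) by (simp add: of_nat_diff)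
  qed (use assms(1) in auto)
  finally show ?thesis .
qed

end
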